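(* Every pure and bounded multilattice contains a restricted submultilattice isomorphic to $\mathrm{ML}_6$.
   Context: Let $(P,\le)$ be a poset. An element $x$ is below $y$ (and $y$ is above $x$) if $x\le y$. For $X\subseteq P$, $\sqcup X$ denotes the set of minimal upper bounds of $X$ and $\sqcap X$ the set of maximal lower bounds of $X$; write $x\sqcup y$, $x\sqcap y$ for $X=\{x,y\}$. The poset $(P,\le)$ is a multilattice if for every finite subset $X$ of $P$, each upper bound of $X$ is above some element of $\sqcup X$ and each lower bound of $X$ is below some element of $\sqcap X$. A multilattice is pure if it is not a lattice, and bounded if it has a least and a greatest element. A nonempty subset $X$ of a multilattice $P$ is a restricted submultilattice if for all $x,y\in X$, $(x\sqcup y)\cap X\neq\emptyset$ and $(x\sqcap y)\cap X\ne\emptyset$ (with $\sqcup,\sqcap$ computed in $P$). Such an $X$ is regarded as a poset with the order induced from $P$. $\mathrm{ML}_6$ is the six-element poset $\{\bot,a,b,c,d,\top\}$ with least element $\bot$, greatest element $\top$, $a$ and $b$ incomparable, $c$ and $d$ incomparable, and each of $a,b$ below each of $c,d$; it is a multilattice. A map $h:M\to P$ between multilattices is a homomorphism if $h(x\sqcup y)\subseteq h(x)\sqcup h(y)$ and $h(x\sqcap y)\subseteq h(x)\sqcap h(y)$ for all $x,y\in M$; it is an isomorphism if it is moreover bijective. "$X$ is isomorphic to $\mathrm{ML}_6$" means that $X$ with the induced order is a multilattice and there is an isomorphism between it and $\mathrm{ML}_6$. *)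

theory Defs
  imports "HOL-Algebra.Lattice"
begin

text \<open>
  Posets are the \<^locale>\<open>partial_order\<close> structures of HOL-Algebra, where the equivalence
  \<open>.=\<close> is equality. The poset induced by \<open>L\<close> on \<open>X \<subseteq> carrier L\<close> is
  \<open>L\<lparr>carrier := X\<rparr>\<close>.
\<close>

definition msup :: "('a, 'm) gorder_scheme \<Rightarrow> 'a set \<Rightarrow> 'a set" where
  "msup L X = {u \<in> Upper L X. \<forall>v \<in> Upper L X. v \<sqsubseteq>\<^bsub>L\<^esub> u \<longrightarrow> v = u}"

definition minf :: "('a, 'm) gorder_scheme \<Rightarrow> 'a set \<Rightarrow> 'a set" where
  "minf L X = {l \<in> Lower L X. \<forall>v \<in> Lower L X. l \<sqsubseteq>\<^bsub>L\<^esub> v \<longrightarrow> v = l}"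

text \<open>
  The finite set \<open>X\<close> may be empty. Then every element is an upper and a lower bound of
  \<open>X\<close>, so every element lies above a minimal and below a maximal one.
\<close>

locale multilattice = partial_order L for L (structure) +
  assumes ex_msup_below:
    "\<lbrakk>finite X; X \<subseteq> carrier L; u \<in> Upper L X\<rbrakk> \<Longrightarrow> \<exists>m \<in> msup L X. m \<sqsubseteq> u"
    and ex_minf_above:
    "\<lbrakk>finite X; X \<subseteq> carrier L; l \<in> Lower L X\<rbrakk> \<Longrightarrow> \<exists>m \<in> minf L X. l \<sqsubseteq> m"

locale pure_multilattice = multilattice +
  assumes not_lattice: "\<not> lattice L"

locale bounded_multilattice =
  multilattice + weak_partial_order_bottom + weak_partial_order_top

definition restricted_submultilattice :: "'a set \<Rightarrow> ('a, 'm) gorder_scheme \<Rightarrow> bool" where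
  "restricted_submultilattice X L \<longleftrightarrow>
     X \<noteq> {} \<and> X \<subseteq> carrier L \<and>
     (\<forall>x \<in> X. \<forall>y \<in> X. msup L {x, y} \<inter> X \<noteq> {} \<and> minf L {x, y} \<inter> X \<noteq> {})"

definition multilattice_hom ::
    "('a, 'm) gorder_scheme \<Rightarrow> ('b, 'n) gorder_scheme \<Rightarrow> ('a \<Rightarrow> 'b) set" where
  "multilattice_hom M P =
     {h \<in> carrier M \<rightarrow> carrier P. \<forall>x \<in> carrier M. \<forall>y \<in> carrier M.
        h ` msup M {x, y} \<subseteq> msup P {h x, h y} \<and>
        h ` minf M {x, y} \<subseteq> minf P {h x, h y}}"

definition multilattice_iso ::
    "('a, 'm) gorder_scheme \<Rightarrow> ('b, 'n) gorder_scheme \<Rightarrow> ('a \<Rightarrow> 'b) set" where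
  "multilattice_iso M P = {h \<in> multilattice_hom M P. bij_betw h (carrier M) (carrier P)}"

text \<open>
  In general the inverse of a bijective homomorphism need not be a homomorphism: if no two
  distinct elements of \<open>M\<close> have a common bound, the homomorphism condition is void for such
  pairs. When \<open>M\<close> is bounded, as \<open>ML6\<close> below is, every such bijection is an order
  isomorphism.
\<close>

definition multilattice_isomorphic ::
    "('a, 'm) gorder_scheme \<Rightarrow> ('b, 'n) gorder_scheme \<Rightarrow> bool" where
  "multilattice_isomorphic M P \<longleftrightarrow>
     multilattice M \<and> multilattice P \<and> multilattice_iso M P \<noteq> {}"

datatype ml6 = Bot6 | A6 | B6 | C6 | D6 | Top6

definition ML6 :: "ml6 gorder" where
  "ML6 = \<lparr>carrier = UNIV, eq = (=),
     le = (\<lambda>x y. x = y \<or> x = Bot6 \<or> y = Top6 \<or> x \<in> {A6, B6} \<and> y \<in> {C6, D6})\<rparr>"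

lemma (in partial_order) finite_ex_minimal:
  assumes "finite A" "A \<subseteq> carrier L" "u \<in> A"
  shows "\<exists>m \<in> A. m \<sqsubseteq> u \<and> (\<forall>v \<in> A. v \<sqsubseteq> m \<longrightarrow> v = m)"
  using assms
proof (induction "card {v \<in> A. v \<sqsubseteq> u}" arbitrary: u rule: less_induct)
  case less
  show ?case
  proof (cases "\<forall>v \<in> A. v \<sqsubseteq> u \<longrightarrow> v = u")
    case True
    then show ?thesis using less.prems le_refl[of u] by (metis subsetD)
  next
    case False
    then obtain v where v: "v \<in> A" "v \<sqsubseteq> u" "v \<noteq> u" by blast
    have c: "u \<in> carrier L" "v \<in> carrier L" using v less.prems by auto
    have tr: "w \<sqsubseteq> u" if "w \<in> A" "w \<sqsubseteq> v" for w
      by (rule le_trans[OF that(2) v(2) _ c(2,1)]) (use that less.prems in auto)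
    have "\<not> u \<sqsubseteq> v" using v(2,3) le_antisym[OF v(2) _ c(2,1)] by metis
    then have "{w \<in> A. w \<sqsubseteq> v} \<subset> {w \<in> A. w \<sqsubseteq> u}"
      using tr less.prems(3) le_refl[OF c(1)] by (auto simp: psubset_eq set_eq_iff)
    then have "card {w \<in> A. w \<sqsubseteq> v} < card {w \<in> A. w \<sqsubseteq> u}"
      using less.prems(1) by (intro psubset_card_mono) auto
    from less.hyps[OF this less.prems(1,2) v(1)] show ?thesis using tr by metis
  qed
qed

lemma finite_poset_multilattice:
  assumes "partial_order L" "finite (carrier L)"
  shows "multilattice L"
proof -
  interpret partial_order L by fact
  interpret d: partial_order "inv_gorder L" by (rule dual_order)
  show ?thesis
  proof
    fix X u assume u: "u \<in> Upper L X"
    have sub: "Upper L X \<subseteq> carrier L" by (rule Upper_closed)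
    from finite_ex_minimal[OF finite_subset[OF sub assms(2)] sub u]
    show "\<exists>m \<in> msup L X. m \<sqsubseteq>\<^bsub>L\<^esub> u" unfolding msup_def by blast
  next
    fix X l assume l: "l \<in> Lower L X"
    have sub: "Lower L X \<subseteq> carrier L" by (rule Lower_closed)
    have "\<exists>m \<in> Lower L X. l \<sqsubseteq>\<^bsub>L\<^esub> m \<and> (\<forall>v \<in> Lower L X. m \<sqsubseteq>\<^bsub>L\<^esub> v \<longrightarrow> v = m)"
      using d.finite_ex_minimal[OF finite_subset[OF sub assms(2)] _ l] sub by simp
    then show "\<exists>m \<in> minf L X. l \<sqsubseteq>\<^bsub>L\<^esub> m" unfolding minf_def by blast
  qed
qed

lemma multilattice_ML6: "multilattice ML6"
proof (rule finite_poset_multilattice)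
  show "partial_order ML6"
    by unfold_locales (simp_all add: ML6_def fun_eq_iff, safe?)
  have "carrier ML6 = {Bot6, A6, B6, C6, D6, Top6}"
    using ml6.exhaust by (auto simp: ML6_def)
  then show "finite (carrier ML6)" by simp
qed

end

theory Submission
  imports Defs
begin

text \<open>
  In a bounded multilattice every finite set has a minimal upper and a maximal lower bound, so
  the lattice property fails only through non-uniqueness: some pair has two distinct minimal
  upper bounds, or two distinct maximal lower bounds. The existence of bounds between given ones
  turns either failure into the other (\<open>two_minf_imp_two_msup\<close>, \<open>two_msup_imp_crown\<close>) and finally
  into a symmetric configuration, called a crown here: \<open>a \<noteq> b\<close> and \<open>c \<noteq> d\<close> such that \<open>c\<close>, \<open>d\<close>
  are minimal upper bounds of \<open>{a, b}\<close> and \<open>a\<close>, \<open>b\<close> are maximal lower bounds of \<open>{c, d}\<close>.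

  A crown forms the four middle elements of a copy of \<open>ML6\<close>. The remaining two elements are
  any \<open>p \<in> a \<sqinter> b\<close> and \<open>q \<in> c \<squnion> d\<close>, which exist by boundedness. The least and the greatest
  element of the poset would give the right order but in general not a restricted
  submultilattice, whose bounds have to be maximal and minimal in the whole poset.
\<close>

section \<open>Minimal upper and maximal lower bounds of a pair\<close>

context partial_order
begin

lemma msup_pair_iff:
  assumes "x \<in> carrier L" "y \<in> carrier L"
  shows "u \<in> msup L {x, y} \<longleftrightarrow> u \<in> carrier L \<and> x \<sqsubseteq> u \<and> y \<sqsubseteq> u \<and>
    (\<forall>v \<in> carrier L. x \<sqsubseteq> v \<longrightarrow> y \<sqsubseteq> v \<longrightarrow> v \<sqsubseteq> u \<longrightarrow> v = u)"
  using assms by (auto simp: msup_def Upper_def)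

lemma minf_pair_iff:
  assumes "x \<in> carrier L" "y \<in> carrier L"
  shows "l \<in> minf L {x, y} \<longleftrightarrow> l \<in> carrier L \<and> l \<sqsubseteq> x \<and> l \<sqsubseteq> y \<and>
    (\<forall>v \<in> carrier L. v \<sqsubseteq> x \<longrightarrow> v \<sqsubseteq> y \<longrightarrow> l \<sqsubseteq> v \<longrightarrow> v = l)"
  using assms by (auto simp: minf_def Lower_def)

lemma msup_le_pair:
  assumes "x \<in> carrier L" "y \<in> carrier L" "x \<sqsubseteq> y"
  shows "y \<in> msup L {x, y}" "y \<in> msup L {y, x}"
  using assms le_antisym by (auto simp: msup_pair_iff)

lemma minf_le_pair:
  assumes "x \<in> carrier L" "y \<in> carrier L" "x \<sqsubseteq> y"
  shows "x \<in> minf L {x, y}" "x \<in> minf L {y, x}"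
  using assms le_antisym by (auto simp: minf_pair_iff)

lemma restrict_partial_order:
  assumes "X \<subseteq> carrier L"
  shows "partial_order (L\<lparr>carrier := X\<rparr>)"
proof
  show "(.=\<^bsub>L\<lparr>carrier := X\<rparr>\<^esub>) = (=)"
    using eq_is_equal by simp
next
  fix x y z assume "x \<in> carrier (L\<lparr>carrier := X\<rparr>)" "y \<in> carrier (L\<lparr>carrier := X\<rparr>)"
    "z \<in> carrier (L\<lparr>carrier := X\<rparr>)" "x \<sqsubseteq>\<^bsub>L\<lparr>carrier := X\<rparr>\<^esub> y" "y \<sqsubseteq>\<^bsub>L\<lparr>carrier := X\<rparr>\<^esub> z"
  with assms show "x \<sqsubseteq>\<^bsub>L\<lparr>carrier := X\<rparr>\<^esub> z" by (auto intro: le_trans[of x y z])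
qed (use assms eq_is_equal in auto)

end

section \<open>From a failure of uniqueness to a crown\<close>

context multilattice
begin

lemma ex_msup_pair_le:
  assumes "x \<in> carrier L" "y \<in> carrier L" "u \<in> carrier L" "x \<sqsubseteq> u" "y \<sqsubseteq> u"
  obtains m where "m \<in> msup L {x, y}" "m \<sqsubseteq> u"
proof -
  have "u \<in> Upper L {x, y}" using assms by (auto simp: Upper_def)
  with assms ex_msup_below[of "{x, y}" u] that show thesis by auto
qed

lemma ex_minf_pair_ge:
  assumes "x \<in> carrier L" "y \<in> carrier L" "l \<in> carrier L" "l \<sqsubseteq> x" "l \<sqsubseteq> y"
  obtains m where "m \<in> minf L {x, y}" "l \<sqsubseteq> m"
proof -
  have "l \<in> Lower L {x, y}" using assms by (auto simp: Lower_def)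
  with assms ex_minf_above[of "{x, y}" l] that show thesis by auto
qed

lemma unique_msup_imp_least:
  assumes "x \<in> carrier L" "y \<in> carrier L" "c \<in> msup L {x, y}"
    and unique: "\<And>d. d \<in> msup L {x, y} \<Longrightarrow> d = c"
  shows "least L c (Upper L {x, y})"
  unfolding least_def
proof (intro conjI ballI)
  show "c \<in> Upper L {x, y}" using assms(3) by (simp add: msup_def)
  fix u assume "u \<in> Upper L {x, y}"
  then obtain m where "m \<in> msup L {x, y}" "m \<sqsubseteq> u"
    using ex_msup_below[of "{x, y}" u] assms(1,2) by auto
  then show "c \<sqsubseteq> u" using unique by blast
qed simp

lemma unique_minf_imp_greatest:
  assumes "x \<in> carrier L" "y \<in> carrier L" "c \<in> minf L {x, y}"
    and unique: "\<And>d. d \<in> minf L {x, y} \<Longrightarrow> d = c"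
  shows "greatest L c (Lower L {x, y})"
  unfolding greatest_def
proof (intro conjI ballI)
  show "c \<in> Lower L {x, y}" using assms(3) by (simp add: minf_def)
  fix l assume "l \<in> Lower L {x, y}"
  then obtain m where "m \<in> minf L {x, y}" "l \<sqsubseteq> m"
    using ex_minf_above[of "{x, y}" l] assms(1,2) by auto
  then show "l \<sqsubseteq> c" using unique by blast
qed simp

text \<open>
  Each of \<open>x\<close>, \<open>y\<close> is an upper bound of \<open>{a, b}\<close> and so has a minimal one below it. If
  these two coincided, they would be a lower bound of \<open>{x, y}\<close> above both \<open>a\<close> and \<open>b\<close>,
  contradicting the maximality of two distinct elements.
\<close>

lemma two_minf_imp_two_msup:
  assumes xy: "x \<in> carrier L" "y \<in> carrier L"
    and ab: "a \<in> minf L {x, y}" "b \<in> minf L {x, y}" "a \<noteq> b"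
  obtains c d where "c \<in> msup L {a, b}" "d \<in> msup L {a, b}" "c \<noteq> d"
proof -
  have car: "a \<in> carrier L" "b \<in> carrier L"
    and le: "a \<sqsubseteq> x" "a \<sqsubseteq> y" "b \<sqsubseteq> x" "b \<sqsubseteq> y"
    using ab xy by (auto simp: minf_pair_iff)
  obtain c where c: "c \<in> msup L {a, b}" "c \<sqsubseteq> x"
    using ex_msup_pair_le[OF car xy(1) le(1,3)] by blast
  obtain d where d: "d \<in> msup L {a, b}" "d \<sqsubseteq> y"
    using ex_msup_pair_le[OF car xy(2) le(2,4)] by blast
  have "c \<noteq> d"
  proof
    assume "c = d"
    with c d have "c = a" "c = b"
      using ab xy car by (auto simp: minf_pair_iff msup_pair_iff)
    with ab(3) show False by simp
  qed
  with c(1) d(1) that show thesis by blast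
qed

text \<open>
  Pushing \<open>x\<close> and \<open>y\<close> up to maximal lower bounds \<open>a\<close>, \<open>b\<close> of \<open>{c, d}\<close> makes the situation
  symmetric: since \<open>a\<close>, \<open>b\<close> lie above \<open>x\<close>, \<open>y\<close>, an upper bound of \<open>{a, b}\<close> is one of \<open>{x, y}\<close>,
  so \<open>c\<close>, \<open>d\<close> remain minimal. For the same reason \<open>a = b\<close> would force \<open>c = a = d\<close>.
\<close>

lemma two_msup_imp_crown:
  assumes xy: "x \<in> carrier L" "y \<in> carrier L"
    and cd: "c \<in> msup L {x, y}" "d \<in> msup L {x, y}" "c \<noteq> d"
  obtains a b where "a \<in> minf L {c, d}" "b \<in> minf L {c, d}" "a \<noteq> b"
    "c \<in> msup L {a, b}" "d \<in> msup L {a, b}"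
proof -
  have car: "c \<in> carrier L" "d \<in> carrier L"
    and le: "x \<sqsubseteq> c" "x \<sqsubseteq> d" "y \<sqsubseteq> c" "y \<sqsubseteq> d"
    using cd xy by (auto simp: msup_pair_iff)
  obtain a where a: "a \<in> minf L {c, d}" "x \<sqsubseteq> a"
    using ex_minf_pair_ge[OF car xy(1) le(1,2)] by blast
  obtain b where b: "b \<in> minf L {c, d}" "y \<sqsubseteq> b"
    using ex_minf_pair_ge[OF car xy(2) le(3,4)] by blast
  have ab: "a \<in> carrier L" "b \<in> carrier L" "a \<sqsubseteq> c" "a \<sqsubseteq> d" "b \<sqsubseteq> c" "b \<sqsubseteq> d"
    using a b car by (auto simp: minf_pair_iff)
  have "a \<noteq> b"
  proof
    assume "a = b"
    with a b ab have "a = c" "a = d"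
      using cd xy by (auto simp: msup_pair_iff)
    with cd(3) show False by simp
  qed
  moreover have up: "x \<sqsubseteq> v" "y \<sqsubseteq> v" if "v \<in> carrier L" "a \<sqsubseteq> v" "b \<sqsubseteq> v" for v
    using that a(2) b(2) ab(1,2) xy le_trans by blast+
  have "c \<in> msup L {a, b}" "d \<in> msup L {a, b}"
    using cd(1,2) up ab car by (simp_all add: msup_pair_iff xy)
  ultimately show thesis using a(1) b(1) that by blast
qed

end

text \<open>
  Boundedness enters here because the lattice property requires each pair to have some upper
  and some lower bound, without which non-uniqueness would not be the only way to fail.
\<close>

lemma pure_bounded_multilattice_crown:
  assumes "pure_multilattice P" "bounded_multilattice P"
  obtains a b c d where
    "a \<in> carrier P" "b \<in> carrier P" "c \<in> carrier P" "d \<in> carrier P" "a \<noteq> b" "c \<noteq> d"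
    "c \<in> msup P {a, b}" "d \<in> msup P {a, b}" "a \<in> minf P {c, d}" "b \<in> minf P {c, d}"
proof -
  interpret pure_multilattice P by fact
  interpret bounded_multilattice P by fact
  have "\<exists>x \<in> carrier P. \<exists>y \<in> carrier P. \<exists>c d. c \<in> msup P {x, y} \<and> d \<in> msup P {x, y} \<and> c \<noteq> d"
  proof (rule ccontr)
    assume none: "\<not> ?thesis"
    have no_inf: "a = b"
      if "x \<in> carrier P" "y \<in> carrier P" "a \<in> minf P {x, y}" "b \<in> minf P {x, y}" for x y a b
    proof (rule ccontr)
      assume "a \<noteq> b"
      from two_minf_imp_two_msup[OF that this] none that show False
        by (metis minf_pair_iff)
    qed
    have "lattice P"
    proof
      fix x y assume xy: "x \<in> carrier P" "y \<in> carrier P"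
      obtain c where "c \<in> msup P {x, y}"
        using ex_msup_pair_le[OF xy top_closed] xy top_higher by blast
      with xy none show "\<exists>s. least P s (Upper P {x, y})"
        by (metis unique_msup_imp_least)
      obtain d where "d \<in> minf P {x, y}"
        using ex_minf_pair_ge[OF xy bottom_closed] xy bottom_lower by blast
      with xy no_inf show "\<exists>s. greatest P s (Lower P {x, y})"
        by (metis unique_minf_imp_greatest)
    qed
    with not_lattice show False by simp
  qed
  then obtain x y c d where xy: "x \<in> carrier P" "y \<in> carrier P"
    and cd: "c \<in> msup P {x, y}" "d \<in> msup P {x, y}" "c \<noteq> d" by blast
  have car: "c \<in> carrier P" "d \<in> carrier P"
    using cd xy by (auto simp: msup_pair_iff)
  obtain a b where ab: "a \<in> minf P {c, d}" "b \<in> minf P {c, d}" "a \<noteq> b"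
    "c \<in> msup P {a, b}" "d \<in> msup P {a, b}"
    by (rule two_msup_imp_crown[OF xy cd])
  have "a \<in> carrier P" "b \<in> carrier P"
    using ab(1,2) car by (auto simp: minf_pair_iff)
  then show thesis by (rule that[OF _ _ car ab(3) cd(3) ab(4,5,1,2)])
qed

section \<open>Copies of the six-element multilattice\<close>

lemma order_iso_imp_multilattice_iso:
  assumes "partial_order M" "partial_order N"
    and bij: "bij_betw h (carrier M) (carrier N)"
    and le_iff: "\<And>x y. x \<in> carrier M \<Longrightarrow> y \<in> carrier M \<Longrightarrow>
      h x \<sqsubseteq>\<^bsub>N\<^esub> h y \<longleftrightarrow> x \<sqsubseteq>\<^bsub>M\<^esub> y"
  shows "h \<in> multilattice_iso M N"
proof -
  interpret M: partial_order M by fact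
  interpret N: partial_order N by fact
  have img: "carrier N = h ` carrier M" using bij by (simp add: bij_betw_def)
  then have "h \<in> multilattice_hom M N"
    unfolding multilattice_hom_def
    by (auto simp: M.msup_pair_iff N.msup_pair_iff M.minf_pair_iff N.minf_pair_iff le_iff)
  with bij show ?thesis by (simp add: multilattice_iso_def)
qed

theorem proposition2p8:
  fixes P :: "('a, 'm) gorder_scheme"
  assumes "pure_multilattice P" and "bounded_multilattice P"
  shows "\<exists>X. restricted_submultilattice X P \<and> multilattice_isomorphic ML6 (P\<lparr>carrier := X\<rparr>)"
proof -
  interpret bounded_multilattice P by fact
  obtain a b c d where
    car: "a \<in> carrier P" "b \<in> carrier P" "c \<in> carrier P" "d \<in> carrier P"
    and neq: "a \<noteq> b" "c \<noteq> d"
    and cd: "c \<in> msup P {a, b}" "d \<in> msup P {a, b}"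
    and ab: "a \<in> minf P {c, d}" "b \<in> minf P {c, d}"
    using pure_bounded_multilattice_crown[OF assms] by blast
  obtain p where p: "p \<in> minf P {a, b}"
    using ex_minf_pair_ge[OF car(1,2) bottom_closed] car bottom_lower by blast
  obtain q where q: "q \<in> msup P {c, d}"
    using ex_msup_pair_le[OF car(3,4) top_closed] car top_higher by blast
  have pq: "p \<in> carrier P" "q \<in> carrier P"
    using p q car by (auto simp: msup_pair_iff minf_pair_iff)
  note car' = car pq
  have le: "p \<sqsubseteq>\<^bsub>P\<^esub> a" "p \<sqsubseteq>\<^bsub>P\<^esub> b" "a \<sqsubseteq>\<^bsub>P\<^esub> c" "a \<sqsubseteq>\<^bsub>P\<^esub> d" "b \<sqsubseteq>\<^bsub>P\<^esub> c" "b \<sqsubseteq>\<^bsub>P\<^esub> d"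
    "c \<sqsubseteq>\<^bsub>P\<^esub> q" "d \<sqsubseteq>\<^bsub>P\<^esub> q"
    using p q cd car by (auto simp: msup_pair_iff minf_pair_iff)
  have le2: "p \<sqsubseteq>\<^bsub>P\<^esub> c" "p \<sqsubseteq>\<^bsub>P\<^esub> d" "a \<sqsubseteq>\<^bsub>P\<^esub> q" "b \<sqsubseteq>\<^bsub>P\<^esub> q"
    using le car' le_trans by blast+
  have le3: "p \<sqsubseteq>\<^bsub>P\<^esub> q"
    using le(1) le2(3) car' le_trans by blast
  \<comment> \<open>Distinct minimal upper bounds, or distinct maximal lower bounds, are incomparable.\<close>
  have nle: "\<not> a \<sqsubseteq>\<^bsub>P\<^esub> b" "\<not> b \<sqsubseteq>\<^bsub>P\<^esub> a" "\<not> c \<sqsubseteq>\<^bsub>P\<^esub> d" "\<not> d \<sqsubseteq>\<^bsub>P\<^esub> c"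
    using neq ab cd car by (metis minf_pair_iff msup_pair_iff)+
  \<comment> \<open>Any further comparability would, by transitivity, compare \<open>a\<close> with \<open>b\<close> or \<open>c\<close> with \<open>d\<close>.\<close>
  have nle2: "\<not> c \<sqsubseteq>\<^bsub>P\<^esub> a" "\<not> d \<sqsubseteq>\<^bsub>P\<^esub> a" "\<not> c \<sqsubseteq>\<^bsub>P\<^esub> b" "\<not> d \<sqsubseteq>\<^bsub>P\<^esub> b"
    "\<not> a \<sqsubseteq>\<^bsub>P\<^esub> p" "\<not> b \<sqsubseteq>\<^bsub>P\<^esub> p" "\<not> q \<sqsubseteq>\<^bsub>P\<^esub> c" "\<not> q \<sqsubseteq>\<^bsub>P\<^esub> d"
    using nle le car' le_trans by blast+
  have nle3: "\<not> c \<sqsubseteq>\<^bsub>P\<^esub> p" "\<not> d \<sqsubseteq>\<^bsub>P\<^esub> p" "\<not> q \<sqsubseteq>\<^bsub>P\<^esub> a" "\<not> q \<sqsubseteq>\<^bsub>P\<^esub> b"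
    using nle2 le car' by (meson le_trans)+
  have nle4: "\<not> q \<sqsubseteq>\<^bsub>P\<^esub> p"
    using nle3(3) le(1) car' by (meson le_trans)
  note order = le le2 le3 nle nle2 nle3 nle4

  define X where "X = {p, a, b, c, d, q}"
  have X: "X \<subseteq> carrier P" using car' by (simp add: X_def)
  have "restricted_submultilattice X P"
    unfolding restricted_submultilattice_def
  proof (intro conjI ballI X)
    show "X \<noteq> {}" by (simp add: X_def)
    fix x y assume xy: "x \<in> X" "y \<in> X"
    then have xy': "x \<in> carrier P" "y \<in> carrier P" using X by auto
    consider "x \<sqsubseteq>\<^bsub>P\<^esub> y" | "y \<sqsubseteq>\<^bsub>P\<^esub> x" | "{x, y} = {a, b}" | "{x, y} = {c, d}"
      using xy order car' unfolding X_def by auto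
    then have "(\<exists>u \<in> X. u \<in> msup P {x, y}) \<and> (\<exists>l \<in> X. l \<in> minf P {x, y})"
    proof cases
      case 1
      then show ?thesis using xy xy' msup_le_pair(1) minf_le_pair(1) by blast
    next
      case 2
      then show ?thesis using xy xy' msup_le_pair(2) minf_le_pair(2) by blast
    next
      case 3
      then show ?thesis using cd p by (auto simp: X_def)
    next
      case 4
      then show ?thesis using ab q by (auto simp: X_def)
    qed
    then show "msup P {x, y} \<inter> X \<noteq> {}" "minf P {x, y} \<inter> X \<noteq> {}" by blast+
  qed
  moreover have "multilattice_isomorphic ML6 (P\<lparr>carrier := X\<rparr>)"
    unfolding multilattice_isomorphic_def
  proof (intro conjI multilattice_ML6)
    have po: "partial_order (P\<lparr>carrier := X\<rparr>)" by (rule restrict_partial_order[OF X])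
    then show "multilattice (P\<lparr>carrier := X\<rparr>)"
      by (rule finite_poset_multilattice) (simp add: X_def)
    have po6: "partial_order ML6" using multilattice_ML6 by (rule multilattice.axioms)
    define h where "h = case_ml6 p a b c d q"
    have le_iff: "h x \<sqsubseteq>\<^bsub>P\<^esub> h y \<longleftrightarrow> x \<sqsubseteq>\<^bsub>ML6\<^esub> y" for x y
      using order car' by (cases x; cases y) (simp_all add: h_def ML6_def)
    have "bij_betw h (carrier ML6) X"
    proof (rule bij_betw_imageI)
      show "inj_on h (carrier ML6)"
      proof (rule inj_onI)
        fix x y assume "h x = h y"
        moreover have "h x \<in> carrier P" "h y \<in> carrier P"
          using car' by (auto simp: h_def split: ml6.split)
        ultimately have "x \<sqsubseteq>\<^bsub>ML6\<^esub> y" "y \<sqsubseteq>\<^bsub>ML6\<^esub> x"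
          using le_iff le_refl by metis+
        then show "x = y" by (auto simp: ML6_def)
      qed
      have "carrier ML6 = {Bot6, A6, B6, C6, D6, Top6}"
        using ml6.exhaust by (auto simp: ML6_def)
      then show "h ` carrier ML6 = X" by (simp add: h_def X_def)
    qed
    then have "h \<in> multilattice_iso ML6 (P\<lparr>carrier := X\<rparr>)"
      by (intro order_iso_imp_multilattice_iso po po6) (simp_all add: le_iff)
    then show "multilattice_iso ML6 (P\<lparr>carrier := X\<rparr>) \<noteq> {}" by blast
  qed
  ultimately show ?thesis by blast
qed

end
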